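(* Let $G$ be an almost simple group whose socle $T$ is a simple exceptional group of Lie type, let $\mathcal{D}=(\mathcal{P},\mathcal{B})$ be a non-trivial $G$-block-transitive $3$-$(v,k,1)$ design, and let $\alpha\in\mathcal{P}$. Then $|G_\alpha|^3>|G|$.
   Context: A $3$-$(v,k,1)$ design $\mathcal{D}=(\mathcal{P},\mathcal{B})$ consists of a finite set $\mathcal{P}$ of $v$ points and a collection $\mathcal{B}$ of $k$-subsets of $\mathcal{P}$, called blocks, such that each $3$-subset of $\mathcal{P}$ lies in a unique block. It is non-trivial if $3<k<v$. An automorphism of $\mathcal{D}$ is a permutation of $\mathcal{P}$ which permutes the blocks among themselves; these form the group $\mathrm{Aut}(\mathcal{D})$. For a subgroup $G\leq \mathrm{Aut}(\mathcal{D})$, the design is $G$-block-transitive if $G$ acts transitively on $\mathcal{B}$. $G_\alpha$ denotes the stabilizer of the point $\alpha$ in $G$. A finite group $G$ is almost simple with socle $T$ if $T\leq G\leq \mathrm{Aut}(T)$ with $T$ non-abelian simple. The simple exceptional groups of Lie type are the finite simple groups in the ten families ${}^2B_2(q)$, ${}^2G_2(q)$, ${}^2F_4(q)$, ${}^3D_4(q)$, ${}^2E_6(q)$, $G_2(q)$, $F_4(q)$, $E_6(q)$, $E_7(q)$, $E_8(q)$ (where $q$ is a prime power, and $q$ is an odd power of $2$, $3$, $2$ respectively for the first three families; the simple derived groups $G_2(2)'$, ${}^2G_2(3)'$, ${}^2F_4(2)'$ are also considered). *)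

theory Defs
  imports "HOL-Algebra.Algebra" "HOL-Library.Function_Algebras"
begin

section \<open>Root systems\<close>

text \<open>
  A root system with simple roots \<open>a\<^sub>0, \<dots>, a\<^sub>l\<^sub>-\<^sub>1\<close> is given by the Gram matrix
  \<open>B ! i ! j = (a\<^sub>i, a\<^sub>j)\<close>, scaled to be integral; \<open>l\<close> is \<open>length B\<close>.
  A root is the function sending \<open>i\<close> to its coefficient at \<open>a\<^sub>i\<close>, and \<open>0\<close> for \<open>i \<ge> l\<close>.
  All uses of \<open>div\<close> below are exact divisions.
\<close>

type_synonym gram = "int list list"
type_synonym root = "nat \<Rightarrow> int"

definition ip :: "gram \<Rightarrow> root \<Rightarrow> root \<Rightarrow> int" where
  "ip B r s = (\<Sum>i<length B. \<Sum>j<length B. r i * (B ! i ! j) * s j)"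

definition simple_root :: "nat \<Rightarrow> root" where
  "simple_root i = (\<lambda>j. if j = i then 1 else 0)"

text \<open>The Cartan integer \<open>A\<^sub>r\<^sub>s = 2(r,s)/(r,r)\<close>.\<close>

definition cartan :: "gram \<Rightarrow> root \<Rightarrow> root \<Rightarrow> int" where
  "cartan B r s = (2 * ip B r s) div ip B r r"

inductive_set roots :: "gram \<Rightarrow> root set" for B :: gram where
  simple: "i < length B \<Longrightarrow> simple_root i \<in> roots B"
| reflect: "r \<in> roots B \<Longrightarrow> i < length B \<Longrightarrow>
    (\<lambda>j. r j - cartan B (simple_root i) r * simple_root i j) \<in> roots B"

definition pos_roots :: "gram \<Rightarrow> root set" where
  "pos_roots B = {r \<in> roots B. \<forall>i. 0 \<le> r i}"

definition neg_roots :: "gram \<Rightarrow> root set" where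
  "neg_roots B = {r \<in> roots B. \<forall>i. r i \<le> 0}"

text \<open>Coefficient of the coroot \<open>2r/(r,r)\<close> at the simple coroot \<open>2a\<^sub>i/(a\<^sub>i,a\<^sub>i)\<close>.\<close>

definition coroot :: "gram \<Rightarrow> root \<Rightarrow> nat \<Rightarrow> int" where
  "coroot B r i = (if i < length B then (r i * (B ! i ! i)) div ip B r r else 0)"


section \<open>Chevalley bases\<close>

datatype basis_elt = H nat | E root

definition basis :: "gram \<Rightarrow> basis_elt set" where
  "basis B = H ` {..<length B} \<union> E ` roots B"

text \<open>
  \<open>bracket B N a b c\<close> is the coefficient of \<open>c\<close> in \<open>[a,b]\<close>, where \<open>[e\<^sub>r,e\<^sub>s] = N r s e\<^sub>r\<^sub>+\<^sub>s\<close>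
  if \<open>r + s\<close> is a root.
\<close>

fun bracket :: "gram \<Rightarrow> (root \<Rightarrow> root \<Rightarrow> int) \<Rightarrow> basis_elt \<Rightarrow> basis_elt \<Rightarrow> basis_elt \<Rightarrow> int" where
  "bracket B N (H i) (H j) c = 0"
| "bracket B N (H i) (E s) c = (if c = E s then cartan B (simple_root i) s else 0)"
| "bracket B N (E r) (H j) c = (if c = E r then - cartan B (simple_root j) r else 0)"
| "bracket B N (E r) (E s) c =
    (if s = - r then (case c of H i \<Rightarrow> coroot B r i | E _ \<Rightarrow> 0)
     else if r + s \<in> roots B \<and> c = E (r + s) then N r s else 0)"

text \<open>
  The structure constants \<open>N\<close> of a Chevalley basis \<open>{h\<^sub>i, e\<^sub>r}\<close> of the complex simple Lie
  algebra with root system \<open>B\<close>: the bracket is a Lie bracket and \<open>N r s = \<plusminus>(p + 1)\<close>, where \<open>p\<close>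
  is greatest with \<open>s - p r\<close> a root. Different choices of \<open>N\<close> only differ by signs and lead
  to isomorphic groups.
\<close>

definition chevalley_constants :: "gram \<Rightarrow> (root \<Rightarrow> root \<Rightarrow> int) \<Rightarrow> bool" where
  "chevalley_constants B N \<longleftrightarrow>
    (\<forall>a\<in>basis B. \<forall>b\<in>basis B. \<forall>c\<in>basis B. bracket B N a b c = - bracket B N b a c) \<and>
    (\<forall>a\<in>basis B. \<forall>b\<in>basis B. \<forall>c\<in>basis B. \<forall>d\<in>basis B.
      (\<Sum>x\<in>basis B. bracket B N a b x * bracket B N x c d
                   + bracket B N b c x * bracket B N x a d
                   + bracket B N c a x * bracket B N x b d) = 0) \<and>
    (\<forall>r\<in>roots B. \<forall>s\<in>roots B. r + s \<in> roots B \<longrightarrow>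
      \<bar>N r s\<bar> = int (GREATEST p. (\<lambda>j. s j - int p * r j) \<in> roots B) + 1)"

text \<open>\<open>ad_power B N r n a b\<close> is the coefficient of \<open>a\<close> in \<open>(ad e\<^sub>r)\<^sup>n b\<close>.\<close>

fun ad_power :: "gram \<Rightarrow> (root \<Rightarrow> root \<Rightarrow> int) \<Rightarrow> root \<Rightarrow> nat \<Rightarrow> basis_elt \<Rightarrow> basis_elt \<Rightarrow> int" where
  "ad_power B N r 0 a b = (if a = b then 1 else 0)"
| "ad_power B N r (Suc n) a b =
    (\<Sum>c\<in>basis B. bracket B N (E r) c a * ad_power B N r n c b)"


section \<open>Chevalley groups\<close>

text \<open>
  The adjoint Chevalley group over a field \<open>K\<close> is generated by the automorphisms
  \<open>x\<^sub>r(t) = exp (t ad e\<^sub>r)\<close> of the Lie algebra over \<open>K\<close> with basis \<open>{h\<^sub>i, e\<^sub>r}\<close>. On the integral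
  form the operators \<open>(ad e\<^sub>r)\<^sup>n / n!\<close> have integer matrices, so the exponential makes sense
  in every characteristic; \<open>(ad e\<^sub>r)\<^sup>4 = 0\<close> always.
\<close>

definition lie_space :: "gram \<Rightarrow> ('k, 'm) ring_scheme \<Rightarrow> (basis_elt \<Rightarrow> 'k) set" where
  "lie_space B K = basis B \<rightarrow>\<^sub>E carrier K"

definition root_entry ::
  "gram \<Rightarrow> (root \<Rightarrow> root \<Rightarrow> int) \<Rightarrow> ('k, 'm) ring_scheme \<Rightarrow> root \<Rightarrow> 'k \<Rightarrow> basis_elt \<Rightarrow> basis_elt \<Rightarrow> 'k" where
  "root_entry B N K r t a b =
    (\<Oplus>\<^bsub>K\<^esub>n\<in>{..<4::nat}. add_pow K (ad_power B N r n a b div fact n) (t [^]\<^bsub>K\<^esub> n))"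

definition root_elt ::
  "gram \<Rightarrow> (root \<Rightarrow> root \<Rightarrow> int) \<Rightarrow> ('k, 'm) ring_scheme \<Rightarrow> root \<Rightarrow> 'k \<Rightarrow> (basis_elt \<Rightarrow> 'k) \<Rightarrow> basis_elt \<Rightarrow> 'k" where
  "root_elt B N K r t =
    (\<lambda>v\<in>lie_space B K. \<lambda>a\<in>basis B. \<Oplus>\<^bsub>K\<^esub>b\<in>basis B. root_entry B N K r t a b \<otimes>\<^bsub>K\<^esub> v b)"

definition root_gen ::
  "gram \<Rightarrow> (root \<Rightarrow> root \<Rightarrow> int) \<Rightarrow> ('k, 'm) ring_scheme \<Rightarrow> root set \<Rightarrow> ((basis_elt \<Rightarrow> 'k) \<Rightarrow> basis_elt \<Rightarrow> 'k) set" where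
  "root_gen B N K R =
    generate (BijGroup (lie_space B K)) {root_elt B N K r t | r t. r \<in> R \<and> t \<in> carrier K}"

definition chevalley_group ::
  "gram \<Rightarrow> (root \<Rightarrow> root \<Rightarrow> int) \<Rightarrow> ('k, 'm) ring_scheme \<Rightarrow> ((basis_elt \<Rightarrow> 'k) \<Rightarrow> basis_elt \<Rightarrow> 'k) monoid" where
  "chevalley_group B N K =
    BijGroup (lie_space B K) \<lparr>carrier := root_gen B N K (roots B)\<rparr>"

text \<open>
  Fields with \<open>q\<close> elements are taken on the carrier type \<^typ>\<open>nat\<close>, which is no restriction
  up to isomorphism.
\<close>

type_synonym chev_group = "((basis_elt \<Rightarrow> nat) \<Rightarrow> basis_elt \<Rightarrow> nat) monoid"

definition chevalley_groups :: "gram \<Rightarrow> nat \<Rightarrow> chev_group set" where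
  "chevalley_groups B q =
    {chevalley_group B N K | N (K :: nat ring).
      chevalley_constants B N \<and> field K \<and> finite (carrier K) \<and> card (carrier K) = q}"


section \<open>Twisted groups\<close>

text \<open>
  Let \<open>\<rho>\<close> be a symmetry of the Dynkin diagram (ignoring the arrow). The automorphism \<open>\<sigma>\<close> of the
  Chevalley group, a product of a graph and a field automorphism, is determined by
  \<open>x\<^sub>r(t) \<mapsto> x\<^sub>s(t ^ e\<^sub>i)\<close> for \<open>r = \<plusminus>a\<^sub>i\<close> and \<open>s = \<plusminus>a\<^bsub>\<rho> i\<^esub>\<close>, since these elements generate.
  With \<open>U\<close> and \<open>V\<close> generated by the positive and the negative root elements, the
  twisted group is generated by the \<open>\<sigma>\<close>-fixed elements of \<open>U\<close> and of \<open>V\<close>.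
\<close>

definition twisting ::
  "gram \<Rightarrow> (root \<Rightarrow> root \<Rightarrow> int) \<Rightarrow> ('k, 'm) ring_scheme \<Rightarrow> nat list \<Rightarrow> nat list \<Rightarrow>
    (((basis_elt \<Rightarrow> 'k) \<Rightarrow> basis_elt \<Rightarrow> 'k) \<Rightarrow> ((basis_elt \<Rightarrow> 'k) \<Rightarrow> basis_elt \<Rightarrow> 'k)) \<Rightarrow> bool" where
  "twisting B N K \<rho> e \<sigma> \<longleftrightarrow>
    \<sigma> \<in> auto (chevalley_group B N K) \<and>
    (\<forall>i<length B. \<forall>t\<in>carrier K.
      \<sigma> (root_elt B N K (simple_root i) t)
        = root_elt B N K (simple_root (\<rho> ! i)) (t [^]\<^bsub>K\<^esub> (e ! i)) \<and>
      \<sigma> (root_elt B N K (- simple_root i) t)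
        = root_elt B N K (- simple_root (\<rho> ! i)) (t [^]\<^bsub>K\<^esub> (e ! i)))"

definition twisted_group ::
  "gram \<Rightarrow> (root \<Rightarrow> root \<Rightarrow> int) \<Rightarrow> ('k, 'm) ring_scheme \<Rightarrow>
    (((basis_elt \<Rightarrow> 'k) \<Rightarrow> basis_elt \<Rightarrow> 'k) \<Rightarrow> ((basis_elt \<Rightarrow> 'k) \<Rightarrow> basis_elt \<Rightarrow> 'k)) \<Rightarrow>
    ((basis_elt \<Rightarrow> 'k) \<Rightarrow> basis_elt \<Rightarrow> 'k) monoid" where
  "twisted_group B N K \<sigma> =
    BijGroup (lie_space B K) \<lparr>carrier := generate (BijGroup (lie_space B K))
      ({u \<in> root_gen B N K (pos_roots B). \<sigma> u = u} \<union>
       {u \<in> root_gen B N K (neg_roots B). \<sigma> u = u})\<rparr>"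

definition twisted_groups :: "gram \<Rightarrow> nat list \<Rightarrow> nat list \<Rightarrow> nat \<Rightarrow> chev_group set" where
  "twisted_groups B \<rho> e n =
    {twisted_group B N K \<sigma> | N (K :: nat ring) \<sigma>.
      chevalley_constants B N \<and> field K \<and> finite (carrier K) \<and> card (carrier K) = n \<and>
      twisting B N K \<rho> e \<sigma>}"


section \<open>The exceptional groups of Lie type\<close>

definition gram_B2 :: gram where
  "gram_B2 = [[4, -2], [-2, 2]]"

definition gram_G2 :: gram where
  "gram_G2 = [[2, -3], [-3, 6]]"

definition gram_D4 :: gram where
  "gram_D4 = [[2, -1, 0, 0], [-1, 2, -1, -1], [0, -1, 2, 0], [0, -1, 0, 2]]"

definition gram_F4 :: gram where
  "gram_F4 = [[4, -2, 0, 0], [-2, 4, -2, 0], [0, -2, 2, -1], [0, 0, -1, 2]]"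

definition gram_E6 :: gram where
  "gram_E6 =
    [[2, 0, -1, 0, 0, 0],
     [0, 2, 0, -1, 0, 0],
     [-1, 0, 2, -1, 0, 0],
     [0, -1, -1, 2, -1, 0],
     [0, 0, 0, -1, 2, -1],
     [0, 0, 0, 0, -1, 2]]"

definition gram_E7 :: gram where
  "gram_E7 =
    [[2, 0, -1, 0, 0, 0, 0],
     [0, 2, 0, -1, 0, 0, 0],
     [-1, 0, 2, -1, 0, 0, 0],
     [0, -1, -1, 2, -1, 0, 0],
     [0, 0, 0, -1, 2, -1, 0],
     [0, 0, 0, 0, -1, 2, -1],
     [0, 0, 0, 0, 0, -1, 2]]"

definition gram_E8 :: gram where
  "gram_E8 =
    [[2, 0, -1, 0, 0, 0, 0, 0],
     [0, 2, 0, -1, 0, 0, 0, 0],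
     [-1, 0, 2, -1, 0, 0, 0, 0],
     [0, -1, -1, 2, -1, 0, 0, 0],
     [0, 0, 0, -1, 2, -1, 0, 0],
     [0, 0, 0, 0, -1, 2, -1, 0],
     [0, 0, 0, 0, 0, -1, 2, -1],
     [0, 0, 0, 0, 0, 0, -1, 2]]"

text \<open>
  In the Suzuki and Ree cases, with \<open>|K| = p\<^bsup>2m+1\<^esup>\<close>, the field automorphism is \<open>t \<mapsto> t\<^bsup>p^m\<^esup>\<close>
  and the graph automorphism has exponent \<open>1\<close> on long and \<open>p\<close> on short simple roots, so that
  \<open>\<sigma>\<^sup>2 = 1\<close>. For \<open>\<^sup>3D\<^sub>4(q)\<close> and \<open>\<^sup>2E\<^sub>6(q)\<close> the field has \<open>q\<^sup>3\<close> and \<open>q\<^sup>2\<close> elements respectively.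
\<close>

definition groups_2B2 :: "nat \<Rightarrow> chev_group set" where
  "groups_2B2 q = (\<Union>m\<in>{m. q = 2 ^ (2 * m + 1)}.
    twisted_groups gram_B2 [1, 0] [2 ^ m, 2 ^ (m + 1)] q)"

definition groups_2G2 :: "nat \<Rightarrow> chev_group set" where
  "groups_2G2 q = (\<Union>m\<in>{m. q = 3 ^ (2 * m + 1)}.
    twisted_groups gram_G2 [1, 0] [3 ^ (m + 1), 3 ^ m] q)"

definition groups_2F4 :: "nat \<Rightarrow> chev_group set" where
  "groups_2F4 q = (\<Union>m\<in>{m. q = 2 ^ (2 * m + 1)}.
    twisted_groups gram_F4 [3, 2, 1, 0] [2 ^ m, 2 ^ m, 2 ^ (m + 1), 2 ^ (m + 1)] q)"

definition groups_3D4 :: "nat \<Rightarrow> chev_group set" where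
  "groups_3D4 q = twisted_groups gram_D4 [2, 1, 3, 0] [q, q, q, q] (q ^ 3)"

definition groups_2E6 :: "nat \<Rightarrow> chev_group set" where
  "groups_2E6 q = twisted_groups gram_E6 [5, 1, 4, 3, 2, 0] [q, q, q, q, q, q] (q ^ 2)"

definition derived_group :: "('a, 'b) monoid_scheme \<Rightarrow> ('a, 'b) monoid_scheme" where
  "derived_group L = L \<lparr>carrier := derived L (carrier L)\<rparr>"

definition exceptional_groups :: "chev_group set" where
  "exceptional_groups =
    (\<Union>q. groups_2B2 q \<union> groups_2G2 q \<union> groups_2F4 q \<union> groups_3D4 q \<union> groups_2E6 q \<union>
         chevalley_groups gram_G2 q \<union> chevalley_groups gram_F4 q \<union>
         chevalley_groups gram_E6 q \<union> chevalley_groups gram_E7 q \<union> chevalley_groups gram_E8 q) \<union>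
    derived_group ` (chevalley_groups gram_G2 2 \<union> groups_2G2 3 \<union> groups_2F4 2)"

definition simple_exceptional_of_lie_type :: "'t monoid \<Rightarrow> bool" where
  "simple_exceptional_of_lie_type T \<longleftrightarrow> simple_group T \<and> (\<exists>L\<in>exceptional_groups. T \<cong> L)"


section \<open>Almost simple groups\<close>

definition inner_auts :: "('t, 'm) monoid_scheme \<Rightarrow> ('t \<Rightarrow> 't) set" where
  "inner_auts T = (\<lambda>x. \<lambda>y\<in>carrier T. x \<otimes>\<^bsub>T\<^esub> y \<otimes>\<^bsub>T\<^esub> inv\<^bsub>T\<^esub> x) ` carrier T"

text \<open>\<open>T \<le> G \<le> Aut(T)\<close>, where \<open>T\<close> is identified with its group of inner automorphisms.\<close>

definition almost_simple_with_socle :: "'g monoid \<Rightarrow> 't monoid \<Rightarrow> bool" where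
  "almost_simple_with_socle G T \<longleftrightarrow>
    finite (carrier G) \<and> simple_group T \<and> \<not> comm_group T \<and>
    (\<exists>A. subgroup A (AutoGroup T) \<and> inner_auts T \<subseteq> A \<and> G \<cong> AutoGroup T \<lparr>carrier := A\<rparr>)"


section \<open>Designs\<close>

definition design3 :: "nat \<Rightarrow> nat \<Rightarrow> 'p set \<Rightarrow> 'p set set \<Rightarrow> bool" where
  "design3 v k P \<B> \<longleftrightarrow> finite P \<and> card P = v \<and>
    (\<forall>b\<in>\<B>. b \<subseteq> P \<and> card b = k) \<and>
    (\<forall>S. S \<subseteq> P \<and> card S = 3 \<longrightarrow> (\<exists>!b. b \<in> \<B> \<and> S \<subseteq> b))"

definition design_auts :: "'p set \<Rightarrow> 'p set set \<Rightarrow> ('p \<Rightarrow> 'p) set" where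
  "design_auts P \<B> = {g \<in> Bij P. (\<lambda>b. g ` b) ` \<B> = \<B>}"

definition AutDesign :: "'p set \<Rightarrow> 'p set set \<Rightarrow> ('p \<Rightarrow> 'p) monoid" where
  "AutDesign P \<B> = BijGroup P \<lparr>carrier := design_auts P \<B>\<rparr>"

definition block_transitive :: "('p \<Rightarrow> 'p) monoid \<Rightarrow> 'p set set \<Rightarrow> bool" where
  "block_transitive G \<B> \<longleftrightarrow> transitive_action G \<B> (\<lambda>g. \<lambda>b\<in>\<B>. g ` b)"

end

theory Submission
  imports Defs "HOL-Combinatorics.Permutations"
begin

text \<open>
  Let \<open>\<lambda>\<close> be the number of blocks through two points, \<open>s\<close> the order of a point stabilizer and \<open>c\<close>
  the order of a block stabilizer. A group that is transitive on blocks is transitive on points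
  (\<open>orbit_eq_points\<close>), because a point orbit meets all blocks in the same number of points and
  double counting leaves no room for a proper subset with this property. Hence \<open>|G| = v s\<close>, the
  claim becomes \<open>v < s\<^sup>2\<close>, and comparing \<open>v s\<close> with \<open>c\<close> times the number of blocks gives

    \<open>s k (k - 1) = c (v - 1) \<lambda>\<close>, where \<open>v = \<lambda> (k - 2) + 2\<close> and \<open>\<lambda> \<ge> k - 1\<close>.

  The last inequality is Fisher's inequality for the derived design at a point, which has blocks of
  size \<open>k - 1\<close>. If \<open>\<lambda> \<ge> k + 1\<close>, these relations force \<open>v < s\<^sup>2\<close>. If \<open>\<lambda> = k - 1\<close>, the derived
  designs are projective planes of order \<open>k - 2\<close>; integrality of the number of blocks leaves
  \<open>k = 4, 6, 12\<close>, and then \<open>s\<close> is a multiple of 7, 7 or 37, while \<open>v\<close> is 8, 22 or 112.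
  If \<open>\<lambda> = k\<close>, the design is an inversive plane of order \<open>n = k - 1\<close>, that is \<open>v = n\<^sup>2 + 1\<close>, and
  \<open>s = c n\<close>, so that only \<open>c = 1\<close> is critical (\<open>block_transitive_3_design_arithmetic\<close>).

  In the critical case only the identity fixes a block. An element with three fixed points fixes the
  block through them, and an involution \<open>g\<close> with a fixed point \<open>x\<close> and a moved point \<open>y\<close> fixes the
  block through \<open>x\<close>, \<open>y\<close>, \<open>g y\<close>. So non-identity elements have at most two fixed points and
  involutions have none. No transitive group with point stabilizers of order \<open>n\<close> on \<open>n\<^sup>2 + 1\<close>
  points behaves like this (\<open>no_transitive_action_on_square_plus_one_points\<close>). An involution
  exists and shows that \<open>n\<close> is odd; it is a product of the odd number \<open>(n\<^sup>2 + 1) / 2\<close> of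
  transpositions, so it is an odd permutation, while point stabilizers have odd order and consist of
  even permutations. The even elements thus have two orbits of length \<open>(n\<^sup>2 + 1) / 2\<close>. A group of
  prime order \<open>p\<close> dividing \<open>n\<close> that fixes a point preserves both orbits, and counting modulo \<open>p\<close>
  shows that it has at least three fixed points.
\<close>

section \<open>Signs of involutions and fixed points of p-groups\<close>

text \<open>Such an involution is a product of \<open>card P div 2\<close> disjoint transpositions.\<close>

lemma sign_on_fixed_point_free_involution:
  assumes "finite P" and "\<And>x. x \<in> P \<Longrightarrow> t x \<in> P"
    and "\<And>x. x \<in> P \<Longrightarrow> t (t x) = x" and "\<And>x. x \<in> P \<Longrightarrow> t x \<noteq> x"
  shows "even (card P) \<and> sign_on P t = (-1) ^ (card P div 2)"
  using assms
proof (induction "card P" arbitrary: P rule: less_induct)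
  case less
  show ?case
  proof (cases "P = {}")
    case True
    then show ?thesis by (simp add: sign_on_def restrict_id_def)
  next
    case False
    then obtain x where x: "x \<in> P" by blast
    define y where "y = t x"
    have y: "y \<in> P" "y \<noteq> x" "t y = x" using x less.prems by (auto simp: y_def)
    define P' where "P' = P - {x, y}"
    have fin': "finite P'" using less.prems(1) by (simp add: P'_def)
    have "{x, y} \<subseteq> P" using x y by blast
    then have card': "card P = card P' + 2"
      using x y less.prems(1) card_mono[of P "{x, y}"] by (simp add: P'_def card_Diff_subset)
    have inv': "t z \<in> P'" if "z \<in> P'" for z
      using that less.prems y_def y by (metis Diff_iff P'_def insert_iff singletonD)
    have IH: "even (card P') \<and> sign_on P' t = (-1) ^ (card P' div 2)"
      by (rule less.hyps) (use card' less.prems fin' inv' in \<open>auto simp: P'_def\<close>)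
    have "bij_betw t P' P'"
      by (rule bij_betw_byWitness[where f' = t]) (use inv' less.prems in \<open>auto simp: P'_def\<close>)
    then have perm': "permutation (restrict_id t P')"
      by (intro permutes_imp_permutation[OF fin'] permutes_restrict_id)
    have "restrict_id t P = Transposition.transpose x y \<circ> restrict_id t P'"
    proof
      fix z
      have "z \<in> P' \<Longrightarrow> t z \<noteq> x \<and> t z \<noteq> y" using inv' by (auto simp: P'_def)
      then show "restrict_id t P z = (Transposition.transpose x y \<circ> restrict_id t P') z"
        using x y y_def
        by (auto simp: restrict_id_def Transposition.transpose_def P'_def)
    qed
    then have "sign_on P t = - sign_on P' t"
      using sign_compose[OF permutation_swap_id[of x y] perm'] y
      by (simp add: sign_on_def sign_swap_id)
    then show ?thesis using IH card' by simp
  qed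
qed

text \<open>
  The points of \<open>S\<close> that are not fixed form orbits whose lengths are non-trivial powers of \<open>p\<close>.
\<close>

lemma (in group_action) p_group_card_cong_fixed_points:
  assumes "Factorial_Ring.prime p" and "order G = p ^ a" and "finite E" and "S \<subseteq> E"
    and inv: "\<And>g x. g \<in> carrier G \<Longrightarrow> x \<in> S \<Longrightarrow> \<phi> g x \<in> S"
  shows "card S mod p = card {x \<in> S. \<forall>g\<in>carrier G. \<phi> g x = x} mod p"
proof -
  define F where "F = {x \<in> S. \<forall>g\<in>carrier G. \<phi> g x = x}"
  define C where "C = orbit G \<phi> ` (S - F)"
  have finS: "finite S" using assms by (meson finite_subset)
  have self: "x \<in> orbit G \<phi> x" if "x \<in> S" for x
    using that assms(4) orbit_refl by blast
  have un: "\<Union>C = S - F"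
  proof
    show "S - F \<subseteq> \<Union>C" using self by (auto simp: C_def)
    show "\<Union>C \<subseteq> S - F"
    proof
      fix y assume "y \<in> \<Union>C"
      then obtain x where x: "x \<in> S - F" and yx: "y \<in> orbit G \<phi> x" by (auto simp: C_def)
      then have y: "y \<in> S" using inv by (auto simp: orbit_def)
      then have "x \<in> orbit G \<phi> y" using orbit_sym[of x y] yx x assms(4) by blast
      then have "y \<in> F \<Longrightarrow> x = y" by (auto simp: orbit_def F_def)
      then show "y \<in> S - F" using y x by blast
    qed
  qed
  have "p dvd card c" if cC: "c \<in> C" for c
  proof -
    obtain x where x: "x \<in> S - F" and c: "c = orbit G \<phi> x" using cC unfolding C_def by blast
    then obtain g where g: "g \<in> carrier G" "\<phi> g x \<noteq> x" by (auto simp: F_def)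
    have "card c dvd p ^ a"
      using orbit_stabilizer_theorem[of x] x assms(2,4) c by (metis DiffD1 dvd_triv_left subsetD)
    then obtain i where i: "card c = p ^ i" using assms(1) divides_primepow_nat by blast
    have "c \<subseteq> S" using un cC by blast
    then have "finite c" using finS finite_subset by blast
    moreover have "{x, \<phi> g x} \<subseteq> c" using self[of x] x g c by (auto simp: orbit_def)
    ultimately have "card c \<noteq> 1" using g by (metis card_1_singletonE insert_subset singletonD)
    then show ?thesis using i by (cases i) auto
  qed
  moreover have "c1 \<inter> c2 = {}" if "c1 \<in> C" "c2 \<in> C" "c1 \<noteq> c2" for c1 c2
    using that disjoint_union[of c1 c2] assms(4) by (fastforce simp: C_def orbits_def)
  ultimately have "p dvd card (\<Union>C)"
    using finS un by (intro dvd_partition) auto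
  moreover have "card S = card (S - F) + card F"
    using finS by (simp add: F_def card_Diff_subset card_mono)
  ultimately show ?thesis
    using un by (simp add: F_def[symmetric] mod_add_left_eq[of "card (S - F)", symmetric])
qed

lemma (in group) exists_element_of_prime_order:
  assumes "finite (carrier G)" and "Factorial_Ring.prime p" and "p dvd order G"
  shows "\<exists>g\<in>carrier G. g \<noteq> \<one> \<and> g [^] p = \<one>"
proof -
  obtain m where "order G = p ^ 1 * m" using assms(3) by auto
  then obtain H where H: "subgroup H G" "card H = p"
    using sylow_thm[OF assms(2) is_group _ assms(1), of 1 m] by auto
  interpret H: group "G\<lparr>carrier := H\<rparr>" using H(1) subgroup_imp_group by blast
  have "\<not> H \<subseteq> {\<one>}" using H(2) prime_gt_1_nat[OF assms(2)] card_mono[of "{\<one>}" H] by auto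
  then obtain g where g: "g \<in> H" "g \<noteq> \<one>" by blast
  have "g [^] p = \<one>"
    using H.pow_order_eq_1[of g] g H nat_pow_consistent[of g p H] by (simp add: order_def)
  then show ?thesis using g H(1) subgroup.mem_carrier by metis
qed

section \<open>Transitive actions on a square plus one points\<close>

text \<open>
  The sign of a permutation colours the points: the colour of \<open>\<phi> g x\<close> is the sign of \<open>\<phi> g\<close>. This
  is well defined since the stabilizer of \<open>x\<close> has odd order, and an involution, being an odd
  permutation, swaps the colours. Thus each colour class has \<open>m = (n\<^sup>2 + 1) / 2\<close> points, and a
  subgroup of prime order \<open>p\<close> in the stabilizer, with \<open>p\<close> dividing \<open>n\<close>, has a number of fixed points
  congruent to \<open>m\<close> modulo \<open>p\<close> in each of them. As \<open>2 m\<close> is 1 modulo \<open>p\<close>, these two numbers are positive and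
  cannot both be 1.
\<close>

lemma (in transitive_action) no_transitive_action_on_square_plus_one_points:
  assumes finE: "finite E" and x: "x \<in> E" and cardE: "card E = n\<^sup>2 + 1"
    and stab: "card (stabilizer G \<phi> x) = n" and n: "2 \<le> n"
    and two: "\<And>g. g \<in> carrier G \<Longrightarrow> g \<noteq> \<one> \<Longrightarrow> card (invariants E \<phi> g) \<le> 2"
    and invol: "\<And>g y. g \<in> carrier G \<Longrightarrow> g \<noteq> \<one> \<Longrightarrow> g \<otimes> g = \<one> \<Longrightarrow> y \<in> E \<Longrightarrow> \<phi> g y \<noteq> y"
  shows False
proof -
  interpret G: group G using group_hom by (rule group_hom.axioms(1))
  define S where "S = stabilizer G \<phi> x"
  have subS: "subgroup S G" unfolding S_def by (rule stabilizer_subgroup[OF x])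
  have SG: "S \<subseteq> carrier G" using subS subgroup.subset by blast
  have orbE: "orbit G \<phi> x = E"
    using x unique_orbit[OF x] element_image[OF _ x] by (fastforce simp: orbit_def)
  have ord: "order G = (n\<^sup>2 + 1) * n"
    using orbit_stabilizer_theorem[OF x] stab cardE orbE by simp
  then have "card (carrier G) > 0" using n by (simp add: order_def)
  then have finG: "finite (carrier G)" using card_gt_0_iff by blast
  have "even (order G)" using ord by simp
  then obtain t where t: "t \<in> carrier G" "t \<noteq> \<one>" "t [^] (2::nat) = \<one>"
    using G.exists_element_of_prime_order[OF finG, of 2] by auto
  then have tt: "t \<otimes> t = \<one>" by (simp add: numeral_2_eq_2)
  have act: "\<phi> (g \<otimes> h) y = \<phi> g (\<phi> h y)" if "g \<in> carrier G" "h \<in> carrier G" "y \<in> E" for g h y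
    using composition_rule that by blast
  have one: "\<phi> \<one> y = y" if "y \<in> E" for y using id_eq_one that by (metis restrict_apply')
  have mem: "\<phi> g y \<in> E" if "g \<in> carrier G" "y \<in> E" for g y using element_image that by blast
  define \<sigma> where "\<sigma> g = sign_on E (\<phi> g)" for g
  have \<sigma>_mult: "\<sigma> (g \<otimes> h) = \<sigma> g * \<sigma> h" if "g \<in> carrier G" "h \<in> carrier G" for g h
  proof -
    have "bij_betw (\<phi> k) E E" if "k \<in> carrier G" for k
      using bij_prop0[OF that] by (simp add: Bij_def)
    then have "sign_on E (\<phi> g \<circ> \<phi> h) = \<sigma> g * \<sigma> h"
      unfolding \<sigma>_def using that finE by (intro sign_on_compose) auto
    moreover have "\<sigma> (g \<otimes> h) = sign_on E (\<phi> g \<circ> \<phi> h)"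
      unfolding \<sigma>_def using act that by (intro sign_on_cong) auto
    ultimately show ?thesis by simp
  qed
  have \<sigma>_one: "\<sigma> \<one> = 1"
  proof -
    have "\<sigma> \<one> = sign_on E (\<lambda>y. y)" unfolding \<sigma>_def using one by (intro sign_on_cong) auto
    then show ?thesis by simp
  qed
  have \<sigma>_cases: "\<sigma> g = 1 \<or> \<sigma> g = -1" for g by (simp add: \<sigma>_def sign_on_def sign_def)
  have \<sigma>_pow: "\<sigma> (g [^] k) = \<sigma> g ^ k" if "g \<in> carrier G" for g and k :: nat
    by (induction k) (use that \<sigma>_one \<sigma>_mult in \<open>auto simp: mult.commute\<close>)
  have evE: "even (n\<^sup>2 + 1)" and \<sigma>t_pow: "\<sigma> t = (-1) ^ ((n\<^sup>2 + 1) div 2)"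
    using sign_on_fixed_point_free_involution[of E "\<phi> t", OF finE] mem[OF t(1)]
      act[OF t(1) t(1)] tt one invol[OF t(1,2) tt]
    by (auto simp: \<sigma>_def cardE)
  then have oddn: "odd n" by simp
  then obtain i where i: "n = 2 * i + 1" by (rule oddE)
  \<comment> \<open>The square of an odd number is 1 modulo 4, so the number of transpositions in \<open>t\<close> is odd.\<close>
  have "(n\<^sup>2 + 1) div 2 = 2 * (i * (i + 1)) + 1" by (simp add: i power2_eq_square algebra_simps)
  then have \<sigma>t: "\<sigma> t = - 1" using \<sigma>t_pow by simp
  have \<sigma>S: "\<sigma> g = 1" if "g \<in> S" for g
  proof -
    interpret S: group "G\<lparr>carrier := S\<rparr>" using subS G.subgroup_imp_group by blast
    have "g [^] n = \<one>"
      using S.pow_order_eq_1[of g] that stab G.nat_pow_consistent[of g n S]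
      by (simp add: order_def S_def)
    then have "\<sigma> g ^ n = 1" using \<sigma>_pow[of g n] that SG \<sigma>_one by auto
    then show ?thesis using \<sigma>_cases[of g] oddn by auto
  qed
  \<comment> \<open>\<open>D 1\<close> and \<open>D (-1)\<close> are the two colour classes.\<close>
  define D where "D e = {\<phi> g x | g. g \<in> carrier G \<and> \<sigma> g = e}" for e
  have wd: "\<sigma> g = \<sigma> h" if gh: "g \<in> carrier G" "h \<in> carrier G" "\<phi> g x = \<phi> h x" for g h
  proof -
    have "\<phi> (inv h \<otimes> g) x = x"
      using gh act[of "inv h" g x] act[of "inv h" h x] one[OF x] x by simp
    then have "inv h \<otimes> g \<in> S" using gh by (simp add: S_def stabilizer_def)
    then have "\<sigma> (h \<otimes> (inv h \<otimes> g)) = \<sigma> h" using \<sigma>_mult[of h "inv h \<otimes> g"] \<sigma>S gh by simp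
    then show ?thesis using gh by (simp add: G.m_assoc[symmetric])
  qed
  have step: "\<phi> g y \<in> D (\<sigma> g * e)" if g: "g \<in> carrier G" and y: "y \<in> D e" for g y e
  proof -
    obtain h where h: "h \<in> carrier G" "\<sigma> h = e" "y = \<phi> h x" using y unfolding D_def by blast
    then have "\<phi> g y = \<phi> (g \<otimes> h) x" "\<sigma> (g \<otimes> h) = \<sigma> g * e" "g \<otimes> h \<in> carrier G"
      using g act[OF g h(1) x] \<sigma>_mult[OF g h(1)] by auto
    then show ?thesis unfolding D_def by blast
  qed
  have DE: "D e \<subseteq> E" for e using mem x by (auto simp: D_def)
  have finD: "finite (D e)" for e using DE finE finite_subset by blast
  have un: "D 1 \<union> D (-1) = E"
  proof
    show "D 1 \<union> D (-1) \<subseteq> E" using DE by blast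
    show "E \<subseteq> D 1 \<union> D (-1)"
      using orbE \<sigma>_cases unfolding D_def orbit_def by blast
  qed
  have disj: "D 1 \<inter> D (-1) = {}"
  proof (rule ccontr)
    assume "D 1 \<inter> D (-1) \<noteq> {}"
    then obtain g h where "g \<in> carrier G" "h \<in> carrier G" "\<sigma> g = 1" "\<sigma> h = -1" "\<phi> g x = \<phi> h x"
      unfolding D_def by blast
    then show False using wd[of g h] by simp
  qed
  have le: "card (D e) \<le> card (D (- e))" for e
  proof (rule card_inj_on_le[of "\<phi> t"])
    show "inj_on (\<phi> t) (D e)" using inj_prop[OF t(1)] DE inj_on_subset by blast
    show "\<phi> t ` D e \<subseteq> D (- e)" using step[OF t(1), of _ e] \<sigma>t by auto
  qed (rule finD)
  have "card (D 1) = card (D (-1))" using le[of 1] le[of "-1"] by simp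
  then have half: "card (D e) * 2 = n\<^sup>2 + 1" if "e = 1 \<or> e = -1" for e
  proof -
    have "card (D 1) + card (D (-1)) = n\<^sup>2 + 1"
      using card_Un_disjoint[OF finD finD disj] un cardE by simp
    then show ?thesis using that \<open>card (D 1) = card (D (-1))\<close> by auto
  qed
  \<comment> \<open>The sign is trivial on the stabilizer of \<open>x\<close>, so its subgroups act on each colour class.\<close>
  obtain p where p: "Factorial_Ring.prime p" "p dvd n" using n prime_factor_nat[of n] by auto
  obtain m where "n = p ^ 1 * m" using p(2) by auto
  then obtain Q where Q: "subgroup Q (G\<lparr>carrier := S\<rparr>)" "card Q = p"
    using sylow_thm[OF p(1) G.subgroup_imp_group[OF subS], of 1 m] stab SG finG
    by (auto simp: order_def S_def[symmetric] finite_subset)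
  have subQ: "subgroup Q G" by (rule G.incl_subgroup[OF subS Q(1)])
  have QS: "Q \<subseteq> S" using subgroup.subset[OF Q(1)] by simp
  interpret Q: group_action "G\<lparr>carrier := Q\<rparr>" E \<phi> by (rule induced_action[OF subQ])
  define F where "F e = {y \<in> D e. \<forall>g\<in>Q. \<phi> g y = y}" for e
  have modp: "card (D e) mod p = card (F e) mod p" for e
  proof -
    have "\<phi> g y \<in> D e" if "g \<in> Q" "y \<in> D e" for g y
      using step[of g y e] \<sigma>S that QS SG by (metis mult_1 subsetD)
    then show ?thesis
      using Q.p_group_card_cong_fixed_points[OF p(1), of 1 "D e"] Q(2) finE DE[of e]
      by (simp add: order_def F_def)
  qed
  have nz: "card (F e) > 0" if "e = 1 \<or> e = -1" for e
  proof (rule ccontr)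
    assume "\<not> 0 < card (F e)"
    then have "p dvd card (D e)" using modp[of e] by (simp add: mod_eq_0_iff_dvd)
    then have "p dvd n\<^sup>2 + 1" using half[OF that] by (metis dvd_mult2)
    moreover have "p dvd n\<^sup>2" using p(2) by (simp add: power2_eq_square)
    ultimately have "p dvd 1" using dvd_add_right_iff by blast
    then show False using p(1) not_prime_unit by blast
  qed
  have "\<not> Q \<subseteq> {\<one>}" using Q(2) prime_gt_1_nat[OF p(1)] card_mono[of "{\<one>}" Q] by auto
  then obtain q where q: "q \<in> Q" "q \<noteq> \<one>" by blast
  have "F 1 \<union> F (-1) \<subseteq> invariants E \<phi> q"
    using DE q by (auto simp: F_def invariants_def)
  moreover have "card (F 1 \<union> F (-1)) = card (F 1) + card (F (-1))"
    using disj finD by (intro card_Un_disjoint) (auto simp: F_def)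
  moreover have "finite (invariants E \<phi> q)" using finE by (simp add: invariants_def)
  ultimately have "card (F 1) + card (F (-1)) \<le> card (invariants E \<phi> q)"
    using card_mono[of "invariants E \<phi> q" "F 1 \<union> F (-1)"] by simp
  also have "\<dots> \<le> 2" using two[of q] q QS SG by blast
  finally have "card (F 1) + card (F (-1)) \<le> 2" .
  then have "card (F 1) = 1" using nz[of 1] nz[of "-1"] by auto
  then have "(card (D 1) * 2) mod p = 2 mod p" using modp[of 1] by (metis mod_mult_left_eq mult_1)
  then have "(n\<^sup>2 + 1) mod p = 2 mod p" using half[of 1] by simp
  moreover have "n\<^sup>2 mod p = 0" using p(2) by (simp add: power2_eq_square)
  then have "(n\<^sup>2 + 1) mod p = 1 mod p" by (metis mod_add_left_eq add_0)
  ultimately have "p dvd 2 - 1" using mod_eq_dvd_iff_nat[of 1 2 p] by simp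
  then show False using p(1) by simp
qed


section \<open>Counting in Steiner 3-designs\<close>

locale steiner_3_design =
  fixes P :: "'p set" and \<B> :: "'p set set" and k :: nat
  assumes design: "design3 (card P) k P \<B>" and k: "3 < k" "k < card P"
begin

lemma finite_points: "finite P"
  using design by (simp add: design3_def)

lemma block:
  assumes "b \<in> \<B>"
  shows "b \<subseteq> P" and "card b = k" and "finite b"
proof -
  have all: "\<forall>b\<in>\<B>. b \<subseteq> P \<and> card b = k" using design unfolding design3_def by (elim conjE)
  show "b \<subseteq> P" "card b = k" using all assms by auto
  then show "finite b" using finite_points finite_subset by blast
qed

lemma finite_blocks: "finite \<B>"
  by (rule finite_subset[of _ "Pow P"]) (use block finite_points in auto)

lemma block_through_three:
  assumes "x \<in> P" "y \<in> P" "z \<in> P" "x \<noteq> y" "x \<noteq> z" "y \<noteq> z"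
  shows "\<exists>!b. b \<in> \<B> \<and> x \<in> b \<and> y \<in> b \<and> z \<in> b"
proof -
  have all: "\<forall>S. S \<subseteq> P \<and> card S = 3 \<longrightarrow> (\<exists>!b. b \<in> \<B> \<and> S \<subseteq> b)"
    using design unfolding design3_def by (elim conjE)
  have "{x, y, z} \<subseteq> P \<and> card {x, y, z} = 3" using assms by simp
  then have "\<exists>!b. b \<in> \<B> \<and> {x, y, z} \<subseteq> b" by (rule all[rule_format])
  then show ?thesis by simp
qed

lemma blocks_eqI:
  assumes "b \<in> \<B>" "c \<in> \<B>" "{x, y, z} \<subseteq> b" "{x, y, z} \<subseteq> c" "x \<noteq> y" "x \<noteq> z" "y \<noteq> z"
  shows "b = c"
proof -
  have "x \<in> P" "y \<in> P" "z \<in> P" using assms(1,3) block(1) by auto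
  then have "\<exists>!b. b \<in> \<B> \<and> x \<in> b \<and> y \<in> b \<and> z \<in> b"
    using assms(5-7) by (rule block_through_three)
  then show ?thesis by (rule ex1E) (use assms(1-4) in blast)
qed

text \<open>
  The numbers of blocks through two points and through one point. Both divisions are exact, by
  \<open>card_points_eq\<close> and \<open>point_degree\<close>; the quotients make it visible that the numbers do not depend
  on the points.
\<close>

definition pair_degree :: nat where
  "pair_degree = (card P - 2) div (k - 2)"

definition point_degree :: nat where
  "point_degree = (card P - 1) * pair_degree div (k - 1)"

text \<open>The blocks through two points partition the other points.\<close>

lemma blocks_through_pair:
  assumes "x \<in> P" "y \<in> P" "x \<noteq> y"
  shows "card {b \<in> \<B>. x \<in> b \<and> y \<in> b} * (k - 2) = card P - 2"
proof -
  let ?T = "{b \<in> \<B>. x \<in> b \<and> y \<in> b}"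
  have "card {z \<in> P - {x, y}. z \<in> b} = k - 2" if "b \<in> ?T" for b
  proof -
    have "{z \<in> P - {x, y}. z \<in> b} = b - {x, y}" using block that by blast
    then show ?thesis using that block assms(3) by (simp add: card_Diff_subset)
  qed
  then have "(\<Sum>z\<in>P - {x, y}. card {b \<in> ?T. z \<in> b}) = (k - 2) * card ?T"
    by (intro sum_multicount) (use finite_points finite_blocks in auto)
  moreover have "card {b \<in> ?T. z \<in> b} = 1" if "z \<in> P - {x, y}" for z
  proof -
    have "\<exists>!b. b \<in> {b \<in> ?T. z \<in> b}" using block_through_three[of x y z] that assms by auto
    then show ?thesis unfolding is_singleton_altdef[symmetric] is_singleton_iff_ex1 by simp
  qed
  moreover have "card (P - {x, y}) = card P - 2"
    using assms finite_points by (simp add: card_Diff_subset)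
  ultimately show ?thesis by (simp add: mult.commute)
qed

lemma card_blocks_through_pair:
  assumes "x \<in> P" "y \<in> P" "x \<noteq> y"
  shows "card {b \<in> \<B>. x \<in> b \<and> y \<in> b} = pair_degree"
proof -
  have "0 < k - 2" using k by simp
  then show ?thesis unfolding pair_degree_def blocks_through_pair[OF assms, symmetric] by simp
qed

lemma exists_point: "\<exists>x. x \<in> P"
proof -
  have "P \<noteq> {}" using k by auto
  then show ?thesis by blast
qed

lemma exists_other_point:
  assumes "finite D" "card D < card P"
  shows "\<exists>y. y \<in> P - D"
  using assms card_mono[of D P] by (meson DiffI not_le subsetI)

lemma card_points_eq: "card P = pair_degree * (k - 2) + 2"
proof -
  obtain x where x: "x \<in> P" using exists_point by blast
  obtain y where "y \<in> P" "y \<noteq> x" using exists_other_point[of "{x}"] k by auto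
  then show ?thesis using blocks_through_pair[OF x] card_blocks_through_pair[OF x] k by force
qed

lemma card_blocks_through_point:
  assumes "x \<in> P"
  shows "card {b \<in> \<B>. x \<in> b} * (k - 1) = (card P - 1) * pair_degree"
proof -
  let ?T = "{b \<in> \<B>. x \<in> b}"
  have "card {z \<in> P - {x}. z \<in> b} = k - 1" if "b \<in> ?T" for b
  proof -
    have "{z \<in> P - {x}. z \<in> b} = b - {x}" using block that by blast
    then show ?thesis using that block by simp
  qed
  then have "(\<Sum>z\<in>P - {x}. card {b \<in> ?T. z \<in> b}) = (k - 1) * card ?T"
    by (intro sum_multicount) (use finite_points finite_blocks in auto)
  moreover have "card {b \<in> ?T. z \<in> b} = pair_degree" if "z \<in> P - {x}" for z
  proof -
    have "{b \<in> ?T. z \<in> b} = {b \<in> \<B>. x \<in> b \<and> z \<in> b}" by blast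
    then show ?thesis using card_blocks_through_pair[of x z] that assms by auto
  qed
  ultimately show ?thesis using assms finite_points by (simp add: mult.commute)
qed

lemma card_blocks_through_point_eq:
  assumes "x \<in> P"
  shows "card {b \<in> \<B>. x \<in> b} = point_degree"
proof -
  have "0 < k - 1" using k by simp
  then show ?thesis unfolding point_degree_def card_blocks_through_point[OF assms, symmetric] by simp
qed

lemma point_degree: "point_degree * (k - 1) = (card P - 1) * pair_degree"
  using exists_point card_blocks_through_point card_blocks_through_point_eq by metis

lemma card_blocks: "card \<B> * k = card P * point_degree"
proof -
  have "{x \<in> P. x \<in> b} = b" if "b \<in> \<B>" for b using block that by blast
  then have "(\<Sum>x\<in>P. card {b \<in> \<B>. x \<in> b}) = k * card \<B>"
    by (intro sum_multicount) (use block finite_points finite_blocks in auto)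
  then show ?thesis using card_blocks_through_point_eq by (simp add: mult.commute)
qed

lemma exists_block_through:
  assumes x: "x \<in> P"
  shows "\<exists>b\<in>\<B>. x \<in> b"
proof -
  obtain y where y: "y \<in> P" "y \<noteq> x" using exists_other_point[of "{x}"] k by auto
  obtain z where z: "z \<in> P" "z \<noteq> x" "z \<noteq> y"
  proof -
    have "card {x, y} < card P" using y k by simp
    then show ?thesis using that exists_other_point[of "{x, y}"] by auto
  qed
  show ?thesis using block_through_three[of x y z] x y z by auto
qed

text \<open>
  Fisher's inequality for the derived design at a point \<open>x\<close>: if a block \<open>b\<close> contains \<open>x\<close> but not
  \<open>w\<close>, joining \<open>w\<close> to the \<open>k - 1\<close> points of \<open>b\<close> other than \<open>x\<close> gives distinct blocks through \<open>x\<close>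
  and \<open>w\<close>.
\<close>

lemma pair_degree_ge: "k - 1 \<le> pair_degree"
proof -
  obtain x where x: "x \<in> P" using exists_point by blast
  obtain b where b: "b \<in> \<B>" "x \<in> b" using exists_block_through[OF x] by blast
  obtain w where w: "w \<in> P" "w \<notin> b"
    using exists_other_point[of b] block(2,3)[OF b(1)] k by auto
  have "\<exists>c. c \<in> \<B> \<and> x \<in> c \<and> w \<in> c \<and> u \<in> c" if "u \<in> b - {x}" for u
  proof -
    have "u \<in> P" "x \<noteq> u" "x \<noteq> w" "w \<noteq> u" using that b w block(1) by auto
    then show ?thesis using block_through_three[of x w u] x w by auto
  qed
  then obtain f where f: "f u \<in> \<B> \<and> x \<in> f u \<and> w \<in> f u \<and> u \<in> f u" if "u \<in> b - {x}" for u
    by metis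
  have "inj_on f (b - {x})"
  proof (rule inj_onI, rule ccontr)
    fix u u' assume u: "u \<in> b - {x}" "u' \<in> b - {x}" "f u = f u'" "u \<noteq> u'"
    then have "f u = b"
      using f[of u] f[of u'] b by (intro blocks_eqI[of _ _ x u u']) auto
    then show False using f[OF u(1)] w by blast
  qed
  then have "card (b - {x}) \<le> card {c \<in> \<B>. x \<in> c \<and> w \<in> c}"
    by (rule card_inj_on_le) (use f finite_blocks in auto)
  moreover have "x \<noteq> w" using b w by blast
  ultimately show ?thesis using card_blocks_through_pair[of x w] x w b block by auto
qed

text \<open>
  Count the pairs of a point \<open>w\<close> in \<open>D\<close> and a block through \<open>w\<close> and a given point. From a point outside
  \<open>D\<close> this gives \<open>card D * pair_degree = c * point_degree\<close>, and from a point of \<open>D\<close> the same equation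
  with \<open>card D\<close> and \<open>c\<close> reduced by one. If both points exist, \<open>pair_degree = point_degree\<close>: every
  block through one point contains all others, contrary to \<open>k < card P\<close>.
\<close>

lemma constant_intersection_imp_all_points:
  assumes "D \<subseteq> P" and "D \<noteq> {}" and c: "\<And>b. b \<in> \<B> \<Longrightarrow> card (b \<inter> D) = c"
  shows "D = P"
proof (rule ccontr)
  assume "D \<noteq> P"
  then obtain y where y: "y \<in> P" "y \<notin> D" using assms(1) by blast
  obtain x where x: "x \<in> D" "x \<in> P" using assms(1,2) by blast
  have finX: "finite D" using assms(1) finite_points finite_subset by blast
  let ?R = "\<lambda>z. {b \<in> \<B>. z \<in> b}"
  have lam: "card {b \<in> ?R u. w \<in> b} = pair_degree" if "u \<in> P" "w \<in> D" "u \<noteq> w" for u w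
  proof -
    have "{b \<in> ?R u. w \<in> b} = {b \<in> \<B>. u \<in> b \<and> w \<in> b}" by blast
    then show ?thesis using card_blocks_through_pair[of u w] that assms(1) by auto
  qed
  have "card {w \<in> D. w \<in> b} = c" if "b \<in> ?R y" for b
  proof -
    have "{w \<in> D. w \<in> b} = b \<inter> D" by blast
    then show ?thesis using c that by simp
  qed
  then have "(\<Sum>w\<in>D. card {b \<in> ?R y. w \<in> b}) = c * card (?R y)"
    by (intro sum_multicount) (use finX finite_blocks in auto)
  moreover have "(\<Sum>w\<in>D. card {b \<in> ?R y. w \<in> b}) = (\<Sum>w\<in>D. pair_degree)"
    by (rule sum.cong[OF refl]) (rule lam[OF y(1)], use y in auto)
  ultimately have out: "card D * pair_degree = c * point_degree"
    using card_blocks_through_point_eq[OF y(1)] by simp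
  have "card {w \<in> D - {x}. w \<in> b} = c - 1" if "b \<in> ?R x" for b
  proof -
    have "{w \<in> D - {x}. w \<in> b} = b \<inter> D - {x}" by blast
    then show ?thesis using that c x by (simp add: block)
  qed
  then have "(\<Sum>w\<in>D - {x}. card {b \<in> ?R x. w \<in> b}) = (c - 1) * card (?R x)"
    by (intro sum_multicount) (use finX finite_blocks in auto)
  moreover have "(\<Sum>w\<in>D - {x}. card {b \<in> ?R x. w \<in> b}) = (\<Sum>w\<in>D - {x}. pair_degree)"
    by (rule sum.cong[OF refl]) (rule lam[OF x(2)], auto)
  ultimately have "(card D - 1) * pair_degree = (c - 1) * point_degree"
    using card_blocks_through_point_eq[OF x(2)] x finX by simp
  moreover obtain a where "card D = Suc a"
    using x(1) finX by (metis card_gt_0_iff empty_iff gr0_implies_Suc)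
  moreover have "c \<noteq> 0"
  proof
    assume "c = 0"
    then show False using out pair_degree_ge k \<open>card D = Suc a\<close> by simp
  qed
  then obtain d where "c = Suc d" using not0_implies_Suc by blast
  ultimately have "point_degree = pair_degree" using out by simp
  then have "pair_degree * (k - 1) = (card P - 1) * pair_degree"
    using point_degree by metis
  then have "pair_degree * (k - 1) = pair_degree * (card P - 1)"
    unfolding mult.commute[of "card P - 1"] .
  moreover have "pair_degree \<noteq> 0" using pair_degree_ge k by linarith
  ultimately have "k - 1 = card P - 1" unfolding mult_cancel1 by blast
  then show False using k by linarith
qed

end

section \<open>The arithmetic of block-transitivity\<close>

text \<open>
  Here \<open>l\<close> is the number of blocks through two points, \<open>N\<close> the number of blocks, and \<open>s\<close> and \<open>c\<close> are
  the orders of the stabilizers of a point and of a block. The exception is the inversive plane of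
  order \<open>k - 1\<close> with a group that is regular on blocks, where \<open>s\<^sup>2 = v - 1\<close> misses the bound by 2.
\<close>

lemma block_transitive_3_design_arithmetic:
  fixes v k l s c N :: nat
  assumes k: "4 \<le> k" and l: "k - 1 \<le> l" and v: "v = l * (k - 2) + 2"
    and N: "N * (k * (k - 1)) = v * ((v - 1) * l)"
    and s: "s * (k * (k - 1)) = c * ((v - 1) * l)" and c: "0 < c"
  shows "v < s\<^sup>2 \<or> l = k \<and> c = 1 \<and> v = (k - 1)\<^sup>2 + 1 \<and> s = k - 1"
proof -
  consider "l = k - 1" | "l = k" | "k + 1 \<le> l" using l by linarith
  then show ?thesis
  proof cases
    case 1
    then have N': "N * k = v * (v - 1)" and s': "s * k = c * (v - 1)"
      using N s k by (auto simp: mult.assoc[symmetric])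
    obtain j where j: "k = j + 3" using k le_Suc_ex[of 3 k] by auto
    have v_minus: "v - 1 = k * j + 3"
      by (simp add: v 1 j algebra_simps)
    then have v_eq: "v = k * j + 4"
      using v by simp
    \<comment> \<open>Modulo \<open>k\<close>, \<open>v\<close> and \<open>v - 1\<close> are 4 and 3; hence \<open>k\<close> divides 12.\<close>
    have "N * k = k * (k * j\<^sup>2 + 7 * j) + 12"
      unfolding N' v_minus unfolding v_eq by (simp add: power2_eq_square algebra_simps)
    then have "k dvd k * (k * j\<^sup>2 + 7 * j) + 12"
      by (metis dvd_triv_right)
    then have "k dvd 12"
      by (metis dvd_add_right_iff dvd_triv_left)
    then have "k \<le> 12" by (rule dvd_imp_le) simp
    then have "k \<in> {4,5,6,7,8,9,10,11,12}" using k by auto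
    then have "k = 4 \<or> k = 6 \<or> k = 12" using \<open>k dvd 12\<close> by auto
    then consider "k = 4" "4 * s = 7 * c" "v = 8" | "k = 6" "6 * s = 21 * c" "v = 22"
      | "k = 12" "12 * s = 111 * c" "v = 112"
      using s' v_minus v_eq j by (elim disjE) auto
    then have "v < s\<^sup>2"
    proof cases
      case 1
      then have "7 \<le> s" using c by presburger
      then have "7\<^sup>2 \<le> s\<^sup>2" by (rule power_mono) simp
      then show ?thesis using 1 by simp
    next
      case 2
      then have "7 \<le> s" using c by presburger
      then have "7\<^sup>2 \<le> s\<^sup>2" by (rule power_mono) simp
      then show ?thesis using 2 by simp
    next
      case 3
      then have "37 \<le> s" using c by presburger
      then have "37\<^sup>2 \<le> s\<^sup>2" by (rule power_mono) simp
      then show ?thesis using 3 by simp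
    qed
    then show ?thesis ..
  next
    case 2
    obtain n where n: "k = n + 1" "3 \<le> n" using k le_Suc_ex[of 1 k] by auto
    have v_minus: "v - 1 = n * n"
      using n by (cases n) (simp_all add: v 2 algebra_simps)
    have v_eq: "v = n * n + 1" using v_minus v by simp
    have "k - 1 = n" using n by simp
    then have "s * (k * n) = c * (n * n * k)" using s unfolding v_minus 2 by simp
    then have "s * (k * n) = (c * n) * (k * n)" by (simp add: mult.assoc mult.commute mult.left_commute)
    then have s_eq: "s = c * n" using n by simp
    show ?thesis
    proof (cases "c = 1")
      case True
      then show ?thesis using s_eq v_eq n 2 by (simp add: power2_eq_square)
    next
      case False
      then have "2 * n \<le> s" using c s_eq by simp
      then have "(2 * n)\<^sup>2 \<le> s\<^sup>2" by (rule power_mono) simp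
      moreover have "1 < n * n" using n mult_le_mono[of 3 n 3 n] by simp
      ultimately show ?thesis using v_eq by (simp add: power2_eq_square)
    qed
  next
    case 3
    obtain j where j: "k = j + 2" "2 \<le> j" using k le_Suc_ex[of 2 k] by auto
    define K where "K = k * (k - 1)"
    \<comment> \<open>Since \<open>s K \<ge> (v - 1) l\<close> and \<open>(v - 1)\<^sup>2 > v (v - 2)\<close>, it suffices that \<open>(v - 2) l\<^sup>2 = l\<^sup>3 j \<ge> K\<^sup>2\<close>.\<close>
    have "K\<^sup>2 < (k + 1) ^ 3 * j"
    proof -
      obtain i where i: "j = i + 2" using j le_Suc_ex[of 2 j] by (auto simp: add.commute)
      have "k = i + 4" "k - 1 = i + 3" using i j by simp_all
      then have "K = (i + 4) * (i + 3)" unfolding K_def by (simp only:)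
      moreover have "(i + 5) ^ 3 * (i + 2)
          = ((i + 4) * (i + 3))\<^sup>2 + (3 * i ^ 3 + 32 * i\<^sup>2 + 107 * i + 106)"
        by (simp add: power2_eq_square power3_eq_cube distrib_left distrib_right)
      moreover have "k + 1 = i + 5" using i j by simp
      ultimately show ?thesis using i by (simp only:)
    qed
    also have "\<dots> \<le> l ^ 3 * j" using 3 by (intro mult_right_mono power_mono) auto
    also have "\<dots> = (v - 2) * l\<^sup>2" by (simp add: v j power2_eq_square power3_eq_cube)
    finally have "v * K\<^sup>2 \<le> v * (v - 2) * l\<^sup>2" by (simp add: mult.assoc)
    also have "\<dots> < (v - 1)\<^sup>2 * l\<^sup>2"
    proof -
      obtain u where "v = u + 2" using v by simp
      then have "v * (v - 2) < (v - 1)\<^sup>2" by (simp add: power2_eq_square algebra_simps)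
      then show ?thesis using 3 by simp
    qed
    also have "\<dots> \<le> (c * ((v - 1) * l))\<^sup>2" using c by (simp add: power_mult_distrib)
    also have "\<dots> = s\<^sup>2 * K\<^sup>2" unfolding s[symmetric] K_def by (simp only: power_mult_distrib)
    finally have "v < s\<^sup>2" by simp
    then show ?thesis ..
  qed
qed

section \<open>Block-transitive groups\<close>

locale block_transitive_3_design =
  steiner_3_design P \<B> k + points: group_action G P \<phi> +
  blocks: transitive_action G \<B> "\<lambda>g. \<lambda>b\<in>\<B>. \<phi> g ` b"
  for P :: "'p set" and \<B> k and G (structure) and \<phi> +
  assumes finite_group: "finite (carrier G)"
begin

lemma image_block:
  assumes "g \<in> carrier G" "b \<in> \<B>"
  shows "\<phi> g ` b \<in> \<B>"
  using blocks.element_image[OF assms refl] assms(2) by simp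

text \<open>
  Since blocks can be moved to each other and an orbit is invariant, an orbit meets all blocks in the
  same number of points.
\<close>

lemma orbit_eq_points:
  assumes x: "x \<in> P"
  shows "orbit G \<phi> x = P"
proof -
  let ?D = "orbit G \<phi> x"
  have DP: "?D \<subseteq> P" using x points.element_image unfolding orbit_def by blast
  have iff: "\<phi> g y \<in> ?D \<longleftrightarrow> y \<in> ?D" if g: "g \<in> carrier G" and y: "y \<in> P" for g y
  proof -
    have gy: "\<phi> g y \<in> P" "\<phi> g y \<in> orbit G \<phi> y"
      using points.element_image[OF g y] g by (auto simp: orbit_def)
    then show ?thesis
      using points.orbit_trans[OF x y gy(1)] points.orbit_trans[OF x gy(1) y]
        points.orbit_sym[OF y gy(1) gy(2)] by blast
  qed
  obtain b where b: "b \<in> \<B>" using exists_block_through[OF x] by blast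
  have "card (c \<inter> ?D) = card (b \<inter> ?D)" if c: "c \<in> \<B>" for c
  proof -
    obtain g where g: "g \<in> carrier G" "\<phi> g ` b = c"
      using blocks.unique_orbit[OF b c] b by auto
    have bP: "y \<in> P" if "y \<in> b" for y using block(1)[OF b] that by (rule subsetD)
    have "c \<inter> ?D = \<phi> g ` (b \<inter> ?D)"
    proof (intro subset_antisym subsetI)
      fix w assume w: "w \<in> c \<inter> ?D"
      then obtain y where "y \<in> b" "w = \<phi> g y" using g(2) by blast
      then show "w \<in> \<phi> g ` (b \<inter> ?D)" using w iff[OF g(1) bP] by simp
    next
      fix w assume "w \<in> \<phi> g ` (b \<inter> ?D)"
      then obtain y where "y \<in> b" "y \<in> ?D" "w = \<phi> g y" by blast
      then show "w \<in> c \<inter> ?D" using g(2) iff[OF g(1) bP] by blast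
    qed
    moreover have "inj_on (\<phi> g) (b \<inter> ?D)"
      by (rule inj_on_subset[OF points.inj_prop[OF g(1)]]) (use bP in blast)
    ultimately show ?thesis by (simp add: card_image)
  qed
  then show ?thesis
    by (rule constant_intersection_imp_all_points[OF DP, rotated]) (use points.orbit_refl[OF x] in auto)
qed

lemma point_transitive: "transitive_action G P \<phi>"
proof
  fix x y assume "x \<in> P" "y \<in> P"
  then have "y \<in> orbit G \<phi> x" using orbit_eq_points by simp
  then show "\<exists>g\<in>carrier G. \<phi> g x = y" by (auto simp: orbit_def)
qed

lemma fixes_three_points_imp_fixes_block:
  assumes g: "g \<in> carrier G" and "3 \<le> card (invariants P \<phi> g)"
  shows "\<exists>b\<in>\<B>. \<phi> g ` b = b"
proof -
  obtain F where F: "F \<subseteq> invariants P \<phi> g" "card F = 3"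
    using obtain_subset_with_card_n[OF assms(2)] by blast
  then obtain x y z where xyz: "F = {x, y, z}" "x \<noteq> y" "x \<noteq> z" "y \<noteq> z"
    by (auto simp: card_3_iff)
  then have P: "x \<in> P" "y \<in> P" "z \<in> P" "\<phi> g x = x" "\<phi> g y = y" "\<phi> g z = z"
    using F by (auto simp: invariants_def)
  then obtain b where b: "b \<in> \<B>" "{x, y, z} \<subseteq> b"
    using block_through_three[OF P(1-3) xyz(2-4)] by auto
  then have "{\<phi> g x, \<phi> g y, \<phi> g z} \<subseteq> \<phi> g ` b" by blast
  then have "\<phi> g ` b = b"
    using P b image_block[OF g] xyz by (intro blocks_eqI[of _ _ x y z]) auto
  then show ?thesis using b by blast
qed

text \<open>
  The involution maps the three points \<open>x\<close>, \<open>y\<close>, \<open>\<phi> g y\<close> to themselves, hence also their block.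
\<close>

lemma fixing_involution_fixes_block:
  assumes g: "g \<in> carrier G" "g \<otimes> g = \<one>" and x: "x \<in> P" "\<phi> g x = x"
    and y: "y \<in> P" "\<phi> g y \<noteq> y"
  shows "\<exists>b\<in>\<B>. \<phi> g ` b = b"
proof -
  let ?z = "\<phi> g y"
  have z: "?z \<in> P" using points.element_image[OF g(1) y(1)] by blast
  have "\<phi> g ?z = \<phi> (g \<otimes> g) y" using points.composition_rule[OF y(1) g(1) g(1)] by simp
  then have gz: "\<phi> g ?z = y" using points.id_eq_one g(2) y(1) by (metis restrict_apply')
  have ne: "x \<noteq> y" "x \<noteq> ?z" "y \<noteq> ?z" using x y gz by auto
  obtain b where b: "b \<in> \<B>" "{x, y, ?z} \<subseteq> b"
    using block_through_three[OF x(1) y(1) z ne] by auto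
  then have "{\<phi> g x, \<phi> g y, \<phi> g ?z} \<subseteq> \<phi> g ` b" by blast
  then have "\<phi> g ` b = b"
    using b image_block[OF g(1)] ne gz x by (intro blocks_eqI[of _ _ x y ?z]) auto
  then show ?thesis using b by blast
qed

text \<open>
  By the arithmetic, a counterexample would be regular on the blocks of an inversive plane. There an
  element that fixes a block is trivial, which bounds the fixed points of the other elements as
  needed to exclude the action.
\<close>

theorem card_points_less_card_stabilizer_squared:
  assumes x: "x \<in> P"
  shows "card P < (card (stabilizer G \<phi> x))\<^sup>2"
proof (rule ccontr)
  define s where "s = card (stabilizer G \<phi> x)"
  assume "\<not> ?thesis"
  then have small: "\<not> card P < s\<^sup>2" by (simp add: s_def)
  obtain b where b: "b \<in> \<B>" using exists_block_through[OF x] by blast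
  let ?\<psi> = "\<lambda>g. \<lambda>b\<in>\<B>. \<phi> g ` b"
  define c where "c = card (stabilizer G ?\<psi> b)"
  have ord: "card P * s = order G"
    using points.orbit_stabilizer_theorem[OF x] orbit_eq_points[OF x] by (simp add: s_def)
  have "orbit G ?\<psi> b = \<B>"
    using blocks.unique_orbit[OF b] blocks.element_image[OF _ b] unfolding orbit_def by blast
  then have ord': "card \<B> * c = order G"
    using blocks.orbit_stabilizer_theorem[OF b] by (simp add: c_def)
  have one: "\<one> \<in> stabilizer G ?\<psi> b" by (rule blocks.stabilizer_one_closed[OF b])
  have fin: "finite (stabilizer G ?\<psi> b)"
    using finite_group by (simp add: stabilizer_def)
  have c: "0 < c" using one fin card_gt_0_iff unfolding c_def by blast
  have N: "card \<B> * (k * (k - 1)) = card P * ((card P - 1) * pair_degree)"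
    using card_blocks point_degree by (metis mult.assoc)
  \<comment> \<open>Both sides are \<open>k (k - 1)\<close> times the order of the group.\<close>
  have "card P * (s * (k * (k - 1))) = card \<B> * (k * (k - 1)) * c"
    using ord ord' by (metis mult.assoc mult.commute)
  also have "\<dots> = card P * (c * ((card P - 1) * pair_degree))"
    unfolding N by (simp add: mult.assoc mult.commute mult.left_commute)
  finally have s: "s * (k * (k - 1)) = c * ((card P - 1) * pair_degree)" using k by simp
  have k': "4 \<le> k" using k by simp
  have c1: "c = 1" and vn: "card P = (k - 1)\<^sup>2 + 1" and sn: "s = k - 1"
    using block_transitive_3_design_arithmetic[OF k' pair_degree_ge card_points_eq N s c] small
    by auto
  have trivial: "g = \<one>" if g: "g \<in> carrier G" and ex: "\<exists>d\<in>\<B>. \<phi> g ` d = d" for g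
  proof -
    obtain d where d: "d \<in> \<B>" "\<phi> g ` d = d" using ex by blast
    have "orbit G ?\<psi> d = \<B>"
      using blocks.unique_orbit[OF d(1)] blocks.element_image[OF _ d(1)] unfolding orbit_def by blast
    then have "card \<B> * card (stabilizer G ?\<psi> d) = card \<B> * c"
      using blocks.orbit_stabilizer_theorem[OF d(1)] ord' by simp
    moreover have "card \<B> > 0" using b finite_blocks card_gt_0_iff by blast
    ultimately have "card (stabilizer G ?\<psi> d) = 1" using c1 by simp
    moreover have "\<one> \<in> stabilizer G ?\<psi> d" by (rule blocks.stabilizer_one_closed[OF d(1)])
    moreover have "g \<in> stabilizer G ?\<psi> d" using g d by (simp add: stabilizer_def)
    ultimately show ?thesis by (metis card_1_singletonE singletonD)
  qed
  show False
  proof (rule transitive_action.no_transitive_action_on_square_plus_one_points[OF point_transitive finite_points x vn])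
    show "card (stabilizer G \<phi> x) = k - 1" using sn by (simp add: s_def)
    show "2 \<le> k - 1" using k by simp
    fix g assume g: "g \<in> carrier G" "g \<noteq> \<one>"
    show two: "card (invariants P \<phi> g) \<le> 2"
      using fixes_three_points_imp_fixes_block[OF g(1)] trivial[OF g(1)] g(2) by fastforce
    fix x assume inv: "g \<otimes> g = \<one>" and x: "x \<in> P"
    have "finite (invariants P \<phi> g)" using finite_points by (simp add: invariants_def)
    then obtain y where "y \<in> P - invariants P \<phi> g"
      using exists_other_point[of "invariants P \<phi> g"] two k by auto
    then have "y \<in> P" "\<phi> g y \<noteq> y" by (auto simp: invariants_def)
    then show "\<phi> g x \<noteq> x"
      using fixing_involution_fixes_block[OF g(1) inv x] trivial[OF g(1)] g(2) by blast
  qed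
qed

end

section \<open>The order of a point stabilizer\<close>

theorem lemma3p2:
  fixes P :: "'p set" and \<B> :: "'p set set" and v k :: nat
    and G :: "('p \<Rightarrow> 'p) monoid" and A :: "('p \<Rightarrow> 'p) set"
    and T :: "'t monoid" and \<alpha> :: 'p
  assumes "design3 v k P \<B>" and "3 < k" and "k < v"
    and "subgroup A (AutDesign P \<B>)" and "G = AutDesign P \<B> \<lparr>carrier := A\<rparr>"
    and "almost_simple_with_socle G T"
    and "simple_exceptional_of_lie_type T"
    and "block_transitive G \<B>"
    and "\<alpha> \<in> P"
  shows "card (stabilizer G (\<lambda>g. g) \<alpha>) ^ 3 > order G"
proof -
  have v: "v = card P" using assms(1) by (simp add: design3_def)
  have trans: "transitive_action G \<B> (\<lambda>g. \<lambda>b\<in>\<B>. g ` b)"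
    using assms(8) by (simp add: block_transitive_def)
  interpret blocks: transitive_action G \<B> "\<lambda>g. \<lambda>b\<in>\<B>. g ` b" by (rule trans)
  have "group G" using blocks.group_hom by (rule group_hom.axioms(1))
  moreover have "(\<lambda>g. g) \<in> hom G (BijGroup P)"
    using subgroup.subset[OF assms(4)]
    by (auto simp: assms(5) hom_def AutDesign_def design_auts_def BijGroup_def)
  ultimately have act: "group_action G P (\<lambda>g. g)"
    by (simp add: group_action_def group_hom_def group_hom_axioms_def group_BijGroup)
  interpret block_transitive_3_design P \<B> k G "\<lambda>g. g"
  proof (intro block_transitive_3_design.intro act trans)
    show "steiner_3_design P \<B> k" using assms(1-3) v by unfold_locales auto
    show "block_transitive_3_design_axioms G"
      using assms(6) by unfold_locales (simp add: almost_simple_with_socle_def)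
  qed
  let ?s = "card (stabilizer G (\<lambda>g. g) \<alpha>)"
  have less: "card P < ?s\<^sup>2" by (rule card_points_less_card_stabilizer_squared[OF assms(9)])
  have "order G = card P * ?s"
    using points.orbit_stabilizer_theorem[OF assms(9)] orbit_eq_points[OF assms(9)] by simp
  also have "\<dots> < ?s\<^sup>2 * ?s" using less by (intro mult_strict_right_mono) (auto intro!: gr0I)
  finally show ?thesis by (simp add: power2_eq_square power3_eq_cube)
qed

end
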